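(* Let $n\ge 1$ and $i\ge 1$ be integers and let $a_1,\ldots,a_i$ and $b_1,\ldots,b_i$ be complex numbers (repetitions allowed), none of which is a negative integer, with $\sum_{\ell=1}^{i}a_\ell=\sum_{\ell=1}^{i}b_\ell$. Then $$\prod_{k=1}^{\infty}\prod_{r=0}^{n-1}\prod_{\ell=1}^{i}\left(\frac{k+a_\ell+r}{k+b_\ell+r}\right)^{(-1)^{r}\binom{n-1}{r}\binom{n+k-2}{n-1}}=\frac{\Gamma(b_1+1)\cdots\Gamma(b_i+1)}{\Gamma(a_1+1)\cdots\Gamma(a_i+1)}=\prod_{k=1}^{\infty}\frac{(k+a_1)\cdots(k+a_i)}{(k+b_1)\cdots(k+b_i)}.$$
   Context: $\Gamma$ is the Euler gamma function. Infinite products over $k$ are limits of partial products, where for each $k$ the finite inner product over $r$ and $\ell$ is a single factor; the identity includes the assertion of convergence. *)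

theory Defs
  imports "HOL-Analysis.Analysis"
begin

end

theory Submission
  imports Defs
begin

text \<open>
  Since no \<open>a\<^sub>l\<close> or \<open>b\<^sub>l\<close> is a negative integer, every factor is a nonzero number with
  an explicit logarithm, namely \<open>h(k) = \<Prod>\<^sub>l (k + a\<^sub>l) / (k + b\<^sub>l) = exp (L(k))\<close> with
  \<open>L(k) = \<Sum>\<^sub>l Ln (1 + a\<^sub>l/k) - Ln (1 + b\<^sub>l/k)\<close>. This turns both products into sums, and
  the branch of the logarithm never matters because all exponents are integers.

  Put \<open>m = n - 1\<close> and write \<open>D f(k) = f(k) - f(k+1)\<close>. The inner product over \<open>r\<close> becomes the
  iterated difference \<open>D\<^sup>m L(k)\<close>, so the first product is the exponential of
  \<open>\<Sum>k\<le>N. (m+k-1 choose m) * D\<^sup>m L(k)\<close>. Because \<open>(m+k-1 choose m)\<close> has the difference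
  \<open>(m+k-2 choose m-1)\<close> in \<open>k\<close>, summation by parts (\<open>weighted_alt_diff_sum_Suc\<close>) lowers \<open>m\<close> by one
  at the cost of the boundary term \<open>(m+N-1 choose m) * D\<^sup>m\<^sup>-\<^sup>1 L(N+1)\<close>; after \<open>m\<close> steps
  the sum \<open>\<Sum>k\<le>N. L(k)\<close> of the second product is left.

  The boundary terms vanish in the limit. The binomial coefficient is of size \<open>N\<^sup>m\<close>, and
  \<open>N\<^sup>m * D\<^sup>m\<^sup>-\<^sup>1 Ln (1 + c/k)\<close> at \<open>k = N\<close> tends to \<open>(m-1)! * c\<close> (\<open>alt_diff_Ln_asymp\<close>), so the
  contributions add up to \<open>(m-1)! * (\<Sum>\<^sub>l a\<^sub>l - b\<^sub>l) = 0\<close>. Hence both products have the same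
  limit, and Euler's limit formula for \<open>Gamma\<close> evaluates the second one; there the condition
  \<open>\<Sum>\<^sub>l a\<^sub>l = \<Sum>\<^sub>l b\<^sub>l\<close> cancels the powers of \<open>N\<close>.
\<close>

section \<open>Iterated differences\<close>

text \<open>
  The \<open>j\<close>-fold iterate of \<open>f(k) \<mapsto> f(k) - f(k+1)\<close> in closed form. This sign, rather than that of
  the usual forward difference, matches the exponents \<open>(-1)\<^sup>r (m choose r)\<close> of the product.
\<close>
definition alt_diff :: "nat \<Rightarrow> (nat \<Rightarrow> complex) \<Rightarrow> nat \<Rightarrow> complex" where
  "alt_diff j f k = (\<Sum>r\<le>j. (-1) ^ r * of_nat (j choose r) * f (k + r))"

lemma alt_diff_0: "alt_diff 0 f k = f k"
  by (simp add: alt_diff_def)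

lemma alt_diff_Suc: "alt_diff (Suc j) f k = alt_diff j f k - alt_diff j f (Suc k)"
proof -
  have "alt_diff (Suc j) f k
      = f k + (\<Sum>r\<le>j. (-1) ^ Suc r * of_nat ((j choose r) + (j choose Suc r)) * f (k + Suc r))"
    unfolding alt_diff_def by (subst sum.atMost_Suc_shift) simp
  also have "\<dots> = (f k + (\<Sum>r\<le>j. (-1) ^ Suc r * of_nat (j choose Suc r) * f (k + Suc r)))
      - alt_diff j f (Suc k)"
    by (simp add: alt_diff_def algebra_simps sum.distrib sum_negf sum_subtractf)
  also have "f k + (\<Sum>r\<le>j. (-1) ^ Suc r * of_nat (j choose Suc r) * f (k + Suc r))
      = (\<Sum>r\<le>Suc j. (-1) ^ r * of_nat (j choose r) * f (k + r))"
    by (simp add: sum.atMost_Suc_shift del: sum.atMost_Suc)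
  also have "\<dots> = alt_diff j f k"
    by (simp add: alt_diff_def)
  finally show ?thesis .
qed

lemma alt_diff_diff: "alt_diff j (\<lambda>k. f k - g k) k = alt_diff j f k - alt_diff j g k"
  by (simp add: alt_diff_def sum_subtractf algebra_simps)

lemma alt_diff_sum: "alt_diff j (\<lambda>k. \<Sum>l\<in>I. f l k) k = (\<Sum>l\<in>I. alt_diff j (f l) k)"
  unfolding alt_diff_def by (subst sum.swap) (simp add: sum_distrib_left)

text \<open>
  The partial fraction expansion of \<open>1 / (w (w+1) \<cdots> (w+j))\<close>, which is what makes the differences
  of \<open>1/w\<close> explicit: one further difference of the right-hand side leaves the numerator
  \<open>(w + j + 1) - w = j + 1\<close> over the common denominator.
\<close>
lemma alt_diff_reciprocal:
  assumes "\<And>r. z + of_nat (k + r) \<noteq> 0"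
  shows "alt_diff j (\<lambda>k. 1 / (z + of_nat k)) k = fact j / pochhammer (z + of_nat k) (Suc j)"
  using assms
proof (induction j arbitrary: k)
  case 0
  show ?case by (simp add: alt_diff_0)
next
  case (Suc j)
  define w where "w = z + of_nat k"
  have nz: "w + of_nat r \<noteq> 0" for r
    using Suc.prems[of r] by (simp add: w_def add.assoc)
  have p: "pochhammer (w + 1) j \<noteq> 0"
    using nz[of "Suc _"] by (auto simp: pochhammer_eq_0_iff add.assoc eq_neg_iff_add_eq_0 add_ac)
  have "alt_diff (Suc j) (\<lambda>k. 1 / (z + of_nat k)) k
      = fact j / pochhammer w (Suc j) - fact j / pochhammer (w + 1) (Suc j)"
    using Suc.IH[of k] Suc.IH[of "Suc k"] Suc.prems Suc.prems[of "Suc _"]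
    by (simp add: alt_diff_Suc w_def add_ac)
  also have "pochhammer w (Suc j) = w * pochhammer (w + 1) j"
    by (rule pochhammer_rec)
  also have "pochhammer (w + 1) (Suc j) = pochhammer (w + 1) j * (w + of_nat (Suc j))"
    by (simp add: pochhammer_Suc add_ac)
  also have "fact j / (w * pochhammer (w + 1) j)
        - fact j / (pochhammer (w + 1) j * (w + of_nat (Suc j)))
      = fact (Suc j) / (w * (pochhammer (w + 1) j * (w + of_nat (Suc j))))"
    using p nz[of 0] nz[of "Suc j"] by (simp add: divide_simps) (simp add: algebra_simps)
  also have "w * (pochhammer (w + 1) j * (w + of_nat (Suc j))) = pochhammer w (Suc (Suc j))"
    unfolding pochhammer_rec[of w "Suc j"] pochhammer_Suc[of "w + 1" j] by (simp add: add_ac)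
  finally show ?case by (simp add: w_def)
qed

section \<open>Differences of the logarithm\<close>

lemma uniform_limit_shift_quotient:
  fixes c :: complex
  shows "uniform_limit (cball 0 R) (\<lambda>N t. of_nat N / (of_nat N + t + c)) (\<lambda>_. 1) sequentially"
proof (rule uniform_limitI)
  fix e :: real assume e: "e > 0"
  define M where "M = \<bar>R\<bar> + norm c"
  have M: "M \<ge> 0" by (simp add: M_def)
  have ev: "\<forall>\<^sub>F N in sequentially. real N > M + M / e"
    by real_asymp
  show "\<forall>\<^sub>F N in sequentially. \<forall>t\<in>cball 0 R.
      dist (of_nat N / (of_nat N + t + c)) 1 < e"
    using ev
  proof eventually_elim
    case (elim N)
    show ?case
    proof
      fix t :: complex assume "t \<in> cball 0 R"
      hence s: "norm (t + c) \<le> M"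
        using norm_triangle_ineq[of t c] by (simp add: M_def)
      have "real N - M \<le> norm (of_nat N + (t + c))"
        using norm_diff_ineq[of "of_nat N" "t + c"] s by simp
      moreover have "M / e < real N - M" using elim by simp
      ultimately have big: "M / e < norm (of_nat N + (t + c))" by linarith
      have Me: "M / e \<ge> 0" using M e by simp
      have nz: "of_nat N + (t + c) \<noteq> 0"
        using big Me by auto
      have "of_nat N / (of_nat N + (t + c)) - 1 = - (t + c) / (of_nat N + (t + c))"
        using nz by (simp add: field_simps)
      hence "dist (of_nat N / (of_nat N + t + c)) 1 = norm (t + c) / norm (of_nat N + (t + c))"
        by (simp only: dist_norm norm_divide norm_minus_cancel add.assoc)
      also have "\<dots> < e"
        using big s e nz by (simp add: divide_less_eq mult.commute)
      finally show "dist (of_nat N / (of_nat N + t + c)) 1 < e" .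
    qed
  qed
qed

text \<open>
  Uniformity in \<open>t\<close> is the point: these functions, up to the factor \<open>j!\<close>, are the derivatives in \<open>t\<close>
  to which the mean value inequality is applied next.
\<close>
lemma uniform_limit_power_over_pochhammer:
  "uniform_limit (cball (0::complex) R)
     (\<lambda>N t. of_nat N ^ k / pochhammer (of_nat N + t) k) (\<lambda>_. 1) sequentially"
proof (induction k)
  case 0
  show ?case by (simp add: uniform_limit_const)
next
  case (Suc k)
  have "uniform_limit (cball (0::complex) R)
     (\<lambda>N t. (of_nat N ^ k / pochhammer (of_nat N + t) k) * (of_nat N / (of_nat N + t + of_nat k)))
     (\<lambda>_. 1 * 1) sequentially"
    by (intro uniform_lim_mult Suc uniform_limit_shift_quotient)
       (auto simp: image_constant_conv)
  thus ?case by (simp add: pochhammer_Suc mult_ac)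
qed

text \<open>
  No expansion of the logarithm is needed if \<open>c\<close> is treated as the variable. As a function of \<open>t\<close>,
  the left-hand side vanishes at \<open>t = 0\<close>, and since \<open>Ln (1 + t/k)\<close> has the derivative
  \<open>1 / (t + k)\<close>, its own derivative is \<open>j! * N\<^sup>j\<^sup>+\<^sup>1 / ((N+t) \<cdots> (N+t+j))\<close>. This tends to
  \<open>j!\<close> uniformly for \<open>|t| \<le> |c|\<close>, so the value at \<open>t = c\<close> tends to \<open>j! * c\<close>.
\<close>
lemma alt_diff_Ln_asymp:
  fixes c :: complex
  shows "(\<lambda>N. of_nat N ^ Suc j * alt_diff j (\<lambda>k. Ln (1 + c / of_nat k)) N)
           \<longlonglongrightarrow> fact j * c"
proof (rule tendstoI)
  fix e :: real assume e: "e > 0"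
  define R where "R = norm c"
  \<comment> \<open>The \<open>+ 1\<close> keeps the denominator positive for \<open>c = 0\<close> and makes the final bound strict.\<close>
  define d where "d = e / (fact j * (R + 1))"
  have R: "R \<ge> 0" by (simp add: R_def)
  have d: "d > 0" using e R by (simp add: d_def)
  have ev1: "\<forall>\<^sub>F N in sequentially. \<forall>t\<in>cball 0 R.
      dist (of_nat N ^ Suc j / pochhammer (of_nat N + t) (Suc j)) (1::complex) < d"
    using uniform_limit_power_over_pochhammer d by (rule uniform_limitD)
  \<comment> \<open>For \<open>N > |c|\<close> the points \<open>1 + t / (N + r)\<close> stay in the right half-plane, off the branch cut.\<close>
  have ev2: "\<forall>\<^sub>F N in sequentially. real N > R"
    by real_asymp
  show "\<forall>\<^sub>F N in sequentially.
      dist (of_nat N ^ Suc j * alt_diff j (\<lambda>k. Ln (1 + c / of_nat k)) N) (fact j * c) < e"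
    using ev1 ev2
  proof eventually_elim
    case (elim N)
    define G where "G t = of_nat N ^ Suc j * alt_diff j (\<lambda>k. Ln (1 + t / of_nat k)) N - fact j * t"
      for t :: complex
    define G' where "G' t = fact j * (of_nat N ^ Suc j / pochhammer (of_nat N + t) (Suc j) - 1)"
      for t :: complex
    have deriv: "(G has_field_derivative G' t) (at t within cball 0 R)" if t: "t \<in> cball 0 R" for t
    proof -
      have small: "norm t < real (N + r)" for r
        using t elim(2) by simp
      have pos: "real (N + r) > 0" for r
        using small[of r] norm_ge_zero[of t] by linarith
      have nz: "t + of_nat (N + r) \<noteq> 0" for r
        using small[of r] by (metis add_eq_0_iff norm_minus_cancel norm_of_nat less_irrefl)
      have "norm (t / of_nat (N + r)) < 1" for r
        using small[of r] pos[of r] by (simp add: norm_divide del: of_nat_add)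
      hence "Re (1 + t / of_nat (N + r)) > 0" for r
        using abs_Re_le_cmod[of "t / of_nat (N + r)"]
        by (smt (verit) plus_complex.sel one_complex.sel)
      hence slit: "1 + t / of_nat (N + r) \<notin> \<real>\<^sub>\<le>\<^sub>0" for r
        using complex_nonpos_Reals_iff by (meson not_less)
      have L: "((\<lambda>t. Ln (1 + t / of_nat (N + r))) has_field_derivative 1 / (t + of_nat (N + r)))
          (at t within cball 0 R)" for r
        using slit[of r] pos[of r] nz[of r]
        by (auto intro!: derivative_eq_intros simp: divide_simps add_ac simp del: of_nat_add)
      have "(G has_field_derivative
          (of_nat N ^ Suc j * alt_diff j (\<lambda>k. 1 / (t + of_nat k)) N - fact j * 1))
          (at t within cball 0 R)"
        unfolding G_def alt_diff_def
        by (intro DERIV_diff DERIV_cmult DERIV_sum L DERIV_ident)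
      also have "alt_diff j (\<lambda>k. 1 / (t + of_nat k)) N
          = fact j / pochhammer (of_nat N + t) (Suc j)"
        using alt_diff_reciprocal[OF nz] by (simp add: add.commute)
      finally show ?thesis
        by (simp add: G'_def algebra_simps)
    qed
    have bound: "norm (G' t) \<le> fact j * d" if "t \<in> cball 0 R" for t
      using bspec[OF elim(1) that] by (simp add: G'_def norm_mult dist_norm)
    have "norm (G c - G 0) \<le> fact j * d * norm (c - 0)"
      by (rule field_differentiable_bound[OF convex_cball deriv bound])
         (use R in \<open>auto simp: R_def\<close>)
    also have "G 0 = 0" by (simp add: G_def alt_diff_def)
    also have "fact j * d * norm (c - 0) = e * (R / (R + 1))"
      using R by (simp add: d_def R_def[symmetric])
    also have "\<dots> < e"
      using R e by (simp add: divide_simps)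
    finally show ?case by (simp add: G_def dist_norm)
  qed
qed

section \<open>Summation by parts\<close>

text \<open>
  Pascal's rule says that \<open>(j+k choose j+1)\<close> has the backward difference \<open>(j+k-1 choose j)\<close>
  in \<open>k\<close>. There is no boundary term at the lower end, since \<open>(j+k choose j+1)\<close> vanishes at \<open>k = 0\<close>.
\<close>
lemma weighted_alt_diff_sum_Suc:
  "(\<Sum>k=1..N. of_nat ((Suc j + k - 1) choose Suc j) * alt_diff (Suc j) f k)
     = (\<Sum>k=1..N. of_nat ((j + k - 1) choose j) * alt_diff j f k)
       - of_nat ((j + N) choose Suc j) * alt_diff j f (Suc N)"
proof (induction N)
  case 0
  show ?case by simp
next
  case (Suc N)
  thus ?case by (simp add: alt_diff_Suc algebra_simps)
qed

text \<open>
  The weight is of the order \<open>N\<^sup>j\<^sup>+\<^sup>1\<close>; the crude bound \<open>((j+1) (N+1))\<^sup>j\<^sup>+\<^sup>1\<close> suffices.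
\<close>
lemma boundary_term_tendsto_0:
  assumes "(\<lambda>N. of_nat N ^ Suc j * alt_diff j f N) \<longlonglongrightarrow> 0"
  shows "(\<lambda>N. of_nat ((j + N) choose Suc j) * alt_diff j f (Suc N)) \<longlonglongrightarrow> 0"
proof (rule Lim_null_comparison)
  define B where "B N = of_nat (Suc j) ^ Suc j * norm (of_nat (Suc N) ^ Suc j * alt_diff j f (Suc N))"
    for N
  show "B \<longlonglongrightarrow> 0"
    unfolding B_def
    using tendsto_mult_left[OF tendsto_norm[OF LIMSEQ_Suc[OF assms]], of "of_nat (Suc j) ^ Suc j"]
    by simp
  have "norm (of_nat ((j + N) choose Suc j) * alt_diff j f (Suc N)) \<le> B N" for N
  proof -
    have "(j + N) choose Suc j \<le> (Suc j * Suc N) ^ Suc j"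
    proof (cases "Suc j \<le> j + N")
      case True
      have "(j + N) choose Suc j \<le> (j + N) ^ Suc j"
        by (rule binomial_le_pow[OF True])
      also have "\<dots> \<le> (Suc j * Suc N) ^ Suc j"
        by (intro power_mono) auto
      finally show ?thesis .
    qed (simp add: binomial_eq_0)
    hence "real ((j + N) choose Suc j) \<le> real ((Suc j * Suc N) ^ Suc j)"
      by (rule of_nat_mono)
    hence le: "real ((j + N) choose Suc j) \<le> real (Suc j) ^ Suc j * real (Suc N) ^ Suc j"
      by (simp only: of_nat_power of_nat_mult power_mult_distrib)
    have "norm (of_nat ((j + N) choose Suc j) * alt_diff j f (Suc N))
        = real ((j + N) choose Suc j) * norm (alt_diff j f (Suc N))"
      by (simp only: norm_mult norm_of_nat)
    also have "\<dots> \<le> real (Suc j) ^ Suc j * real (Suc N) ^ Suc j * norm (alt_diff j f (Suc N))"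
      by (rule mult_right_mono[OF le norm_ge_zero])
    also have "\<dots> = B N"
      by (simp only: B_def norm_mult norm_power norm_of_nat mult.assoc)
    finally show ?thesis .
  qed
  thus "\<forall>\<^sub>F N in sequentially.
      norm (of_nat ((j + N) choose Suc j) * alt_diff j f (Suc N)) \<le> B N"
    by simp
qed

lemma weighted_alt_diff_sum_limit:
  assumes "\<And>j. (\<lambda>N. of_nat N ^ Suc j * alt_diff j f N) \<longlonglongrightarrow> 0"
  shows "(\<lambda>N. (\<Sum>k=1..N. of_nat ((j + k - 1) choose j) * alt_diff j f k) - (\<Sum>k=1..N. f k))
           \<longlonglongrightarrow> 0"
proof (induction j)
  case 0
  show ?case by (simp add: alt_diff_0)
next
  case (Suc j)
  from tendsto_diff[OF Suc boundary_term_tendsto_0[OF assms, of j]]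
  show ?case
    unfolding weighted_alt_diff_sum_Suc by (simp add: algebra_simps)
qed

section \<open>The two products\<close>

text \<open>
  By Euler's formula, \<open>(c+1) (c+2) \<cdots> (c+N)\<close> behaves like \<open>(N-1)! * N\<^sup>c\<^sup>+\<^sup>1 / Gamma (c+1)\<close>.
  In the quotient the factorials cancel because there are equally many factors above and below, and
  the powers of \<open>N\<close> cancel because the two sums agree.
\<close>
lemma Gamma_quotient_product_limit:
  fixes a b :: "'i \<Rightarrow> complex"
  assumes "finite I"
    and a: "\<And>l. l \<in> I \<Longrightarrow> a l + 1 \<notin> \<int>\<^sub>\<le>\<^sub>0"
    and sums: "(\<Sum>l\<in>I. a l) = (\<Sum>l\<in>I. b l)"
  shows "(\<lambda>N. \<Prod>k=1..N. (\<Prod>l\<in>I. of_nat k + a l) / (\<Prod>l\<in>I. of_nat k + b l))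
           \<longlonglongrightarrow> (\<Prod>l\<in>I. Gamma (b l + 1)) / (\<Prod>l\<in>I. Gamma (a l + 1))"
proof -
  have shifted: "(\<Prod>k=1..N. of_nat k + c) = pochhammer (c + 1) N" for c :: complex and N
    by (induction N) (simp_all add: pochhammer_Suc add_ac)
  have "(\<lambda>N. (\<Prod>l\<in>I. Gamma_series' (b l + 1) N) / (\<Prod>l\<in>I. Gamma_series' (a l + 1) N))
      \<longlonglongrightarrow> (\<Prod>l\<in>I. Gamma (b l + 1)) / (\<Prod>l\<in>I. Gamma (a l + 1))"
    using assms(1) a
    by (intro tendsto_divide tendsto_prod Gamma_series'_LIMSEQ)
       (auto simp: Gamma_eq_zero_iff)
  moreover have "\<forall>\<^sub>F N in sequentially.
      (\<Prod>l\<in>I. Gamma_series' (b l + 1) N) / (\<Prod>l\<in>I. Gamma_series' (a l + 1) N)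
      = (\<Prod>k=1..N. (\<Prod>l\<in>I. of_nat k + a l) / (\<Prod>l\<in>I. of_nat k + b l))"
    using eventually_gt_at_top[of 0]
  proof eventually_elim
    case (elim N)
    define w where "w c = exp ((c + 1) * of_real (ln (of_nat N)))" for c :: complex
    have split: "(\<Prod>l\<in>I. Gamma_series' (c l + 1) N)
        = fact (N - 1) ^ card I * (\<Prod>l\<in>I. w (c l)) / (\<Prod>l\<in>I. pochhammer (c l + 1) N)"
      for c :: "'i \<Rightarrow> complex"
      by (simp add: Gamma_series'_def w_def prod.distrib prod_dividef)
    have "(\<Prod>l\<in>I. w (c l)) = exp (((\<Sum>l\<in>I. c l) + of_nat (card I)) * of_real (ln (of_nat N)))"
      for c :: "'i \<Rightarrow> complex"
      using assms(1)
      by (simp add: w_def exp_sum[symmetric] sum.distrib sum_distrib_right distrib_right)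
    hence same: "(\<Prod>l\<in>I. w (b l)) = (\<Prod>l\<in>I. w (a l))"
      by (simp add: sums)
    have "(\<Prod>l\<in>I. w (a l)) \<noteq> 0"
      using assms(1) by (simp add: w_def)
    hence "(\<Prod>l\<in>I. Gamma_series' (b l + 1) N) / (\<Prod>l\<in>I. Gamma_series' (a l + 1) N)
        = (\<Prod>l\<in>I. pochhammer (a l + 1) N) / (\<Prod>l\<in>I. pochhammer (b l + 1) N)"
      unfolding split same by simp
    also have "\<dots> = (\<Prod>k=1..N. (\<Prod>l\<in>I. of_nat k + a l) / (\<Prod>l\<in>I. of_nat k + b l))"
      unfolding shifted[symmetric] prod_dividef
      by (simp only: prod.swap[of _ I])
    finally show ?case .
  qed
  ultimately show ?thesis
    by (rule Lim_transform_eventually)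
qed

theorem theorem4p5:
  fixes n i :: nat and a b :: "nat \<Rightarrow> complex"
  assumes "n \<ge> 1" and "i \<ge> 1"
    and "\<forall>l\<in>{1..i}. \<forall>m::int. m < 0 \<longrightarrow> a l \<noteq> of_int m"
    and "\<forall>l\<in>{1..i}. \<forall>m::int. m < 0 \<longrightarrow> b l \<noteq> of_int m"
    and "(\<Sum>l=1..i. a l) = (\<Sum>l=1..i. b l)"
  shows "(\<lambda>N. \<Prod>k=1..N. \<Prod>r=0..n-1. \<Prod>l=1..i.
            ((of_nat k + a l + of_nat r) / (of_nat k + b l + of_nat r)) powi
              ((-1) ^ r * int ((n - 1) choose r) * int ((n + k - 2) choose (n - 1))))
          \<longlonglongrightarrow> (\<Prod>l=1..i. Gamma (b l + 1)) / (\<Prod>l=1..i. Gamma (a l + 1))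
       \<and> (\<lambda>N. \<Prod>k=1..N. (\<Prod>l=1..i. of_nat k + a l) / (\<Prod>l=1..i. of_nat k + b l))
          \<longlonglongrightarrow> (\<Prod>l=1..i. Gamma (b l + 1)) / (\<Prod>l=1..i. Gamma (a l + 1))"
proof -
  define m where "m = n - 1"
  have n: "n = Suc m" using assms(1) by (simp add: m_def)
  define Q where "Q = (\<Prod>l=1..i. Gamma (b l + 1)) / (\<Prod>l=1..i. Gamma (a l + 1))"
  define u where "u l k = Ln (1 + a l / of_nat k) - Ln (1 + b l / of_nat k)" for l k
  define L where "L k = (\<Sum>l=1..i. u l k)" for k

  have nz: "of_nat k + a l \<noteq> 0" "of_nat k + b l \<noteq> 0" if "l \<in> {1..i}" "k \<ge> 1" for l k
  proof -
    have "- int k < 0" using that by simp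
    hence "a l \<noteq> of_int (- int k)" "b l \<noteq> of_int (- int k)"
      using assms(3,4) that(1) by blast+
    thus "of_nat k + a l \<noteq> 0" "of_nat k + b l \<noteq> 0"
      by (auto simp: add_eq_0_iff)
  qed
  have exp_u: "exp (u l k) = (of_nat k + a l) / (of_nat k + b l)"
    if "l \<in> {1..i}" "k \<ge> 1" for l k
  proof -
    have "1 + c / of_nat k = (of_nat k + c) / of_nat k" for c :: complex
      using that by (simp add: field_simps)
    thus ?thesis
      using nz[OF that] that by (simp add: u_def exp_diff)
  qed

  have plain: "(\<lambda>N. \<Prod>k=1..N. (\<Prod>l=1..i. of_nat k + a l) / (\<Prod>l=1..i. of_nat k + b l)) \<longlonglongrightarrow> Q"
    unfolding Q_def
  proof (rule Gamma_quotient_product_limit)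
    fix l assume l: "l \<in> {1..i}"
    show "a l + 1 \<notin> \<int>\<^sub>\<le>\<^sub>0"
    proof
      assume "a l + 1 \<in> \<int>\<^sub>\<le>\<^sub>0"
      then obtain k where "a l + 1 = - of_nat k"
        by (auto elim: nonpos_Ints_cases')
      thus False using nz(1)[OF l, of "Suc k"] by (simp add: add_ac eq_neg_iff_add_eq_0)
    qed
  qed (use assms(5) in auto)
  have exp_L: "exp (\<Sum>k=1..N. L k)
      = (\<Prod>k=1..N. (\<Prod>l=1..i. of_nat k + a l) / (\<Prod>l=1..i. of_nat k + b l))" for N
    unfolding L_def exp_sum[OF finite_atLeastAtMost] prod_dividef[symmetric]
    by (intro prod.cong refl exp_u) auto

  have decay: "(\<lambda>N. of_nat N ^ Suc j * alt_diff j L N) \<longlonglongrightarrow> 0" for j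
  proof -
    have "(\<lambda>N. \<Sum>l=1..i. of_nat N ^ Suc j * alt_diff j (\<lambda>k. Ln (1 + a l / of_nat k)) N
              - of_nat N ^ Suc j * alt_diff j (\<lambda>k. Ln (1 + b l / of_nat k)) N)
        \<longlonglongrightarrow> (\<Sum>l=1..i. fact j * a l - fact j * b l)"
      by (intro tendsto_sum tendsto_diff alt_diff_Ln_asymp)
    also have "(\<Sum>l=1..i. fact j * a l - fact j * b l) = 0"
      using assms(5) by (simp add: sum_subtractf sum_distrib_left[symmetric])
    finally show ?thesis
      unfolding L_def[abs_def] u_def[abs_def] alt_diff_sum alt_diff_diff
      by (simp only: sum_distrib_left right_diff_distrib)
  qed

  define S where "S N = (\<Sum>k=1..N. of_nat ((m + k - 1) choose m) * alt_diff m L k)" for N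
  have exp_S: "exp (S N) = (\<Prod>k=1..N. \<Prod>r=0..n-1. \<Prod>l=1..i.
            ((of_nat k + a l + of_nat r) / (of_nat k + b l + of_nat r)) powi
              ((-1) ^ r * int ((n - 1) choose r) * int ((n + k - 2) choose (n - 1))))" for N
  proof -
    have "exp (S N) = (\<Prod>k=1..N. \<Prod>r=0..m. \<Prod>l=1..i.
        exp (of_int ((-1) ^ r * int (m choose r) * int ((m + k - 1) choose m)) * u l (k + r)))"
      by (simp add: S_def L_def alt_diff_def exp_sum[symmetric] sum_distrib_left mult_ac
            atMost_atLeast0)
    also have "\<dots> = (\<Prod>k=1..N. \<Prod>r=0..n-1. \<Prod>l=1..i.
            ((of_nat k + a l + of_nat r) / (of_nat k + b l + of_nat r)) powi
              ((-1) ^ r * int ((n - 1) choose r) * int ((n + k - 2) choose (n - 1))))"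
    proof (intro prod.cong)
      fix k r l assume k: "k \<in> {1..N}" and l: "l \<in> {1..i}"
      have e: "exp (u l (k + r)) = (of_nat k + a l + of_nat r) / (of_nat k + b l + of_nat r)"
        using exp_u[OF l, of "k + r"] k by (simp add: add_ac)
      show "exp (of_int ((-1) ^ r * int (m choose r) * int ((m + k - 1) choose m)) * u l (k + r))
          = ((of_nat k + a l + of_nat r) / (of_nat k + b l + of_nat r)) powi
              ((-1) ^ r * int ((n - 1) choose r) * int ((n + k - 2) choose (n - 1)))"
        unfolding e[symmetric] by (simp add: n exp_power_int mult_ac)
    qed (simp_all add: n)
    finally show ?thesis .
  qed
  have "(\<lambda>N. exp (S N - (\<Sum>k=1..N. L k)) * exp (\<Sum>k=1..N. L k)) \<longlonglongrightarrow> exp 0 * Q"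
    unfolding S_def
    by (intro tendsto_mult tendsto_exp weighted_alt_diff_sum_limit decay)
       (unfold exp_L, rule plain)
  hence "(\<lambda>N. exp (S N)) \<longlonglongrightarrow> Q"
    by (simp add: exp_add[symmetric])
  with plain show ?thesis
    unfolding exp_S Q_def by blast
qed

end
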